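(* Let $1<p<\infty$. Let $\omega$ be a real function analytic in a neighborhood of $[0,\infty)$, positive and non-increasing on $[0,\infty)$, such that $\lambda(x)=-1/\omega'(x^2)$ is a positive, increasing, smooth function on $[0,\infty)$. Suppose that $\liminf_{x\to\infty}S(x,\lambda)>0$ and that there is a constant $C>0$ with $-\omega'(r)\ge C\,\omega(r)$ for all sufficiently large $r$. If $f$ is an entire function with $D_p(\infty,f;\omega)<\infty$, then \[ \lim_{r\to\infty}r^3M_p^p(r,f)\,\omega(r^2)=0 . \]
   Context: For a positive increasing smooth function $\lambda$ and $x_0>0$, $S(x_0,\lambda)=\int_{x_0}^\infty\frac{\lambda(x_0)}{\lambda(x)}\left(\frac{x}{x_0}\right)^{x_0\lambda'(x_0)/\lambda(x_0)}dx$. For an entire function $f$, $M_p(r,f)=\left(\int_0^{2\pi}|f(re^{i\theta})|^p\,d\theta\right)^{1/p}$ and $D_p(\infty,f;\omega)=\left(-\int_{\mathbb{C}}|z|^2|f(z)|^p\,\omega'(|z|^2)\,dA(z)\right)^{1/p}$, where $dA$ is area measure. *)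

theory Defs
  imports "HOL-Analysis.Analysis"
begin

definition real_analytic_on :: "(real \<Rightarrow> real) \<Rightarrow> real set \<Rightarrow> bool" where
  "real_analytic_on g U \<longleftrightarrow>
     (\<forall>x\<in>U. \<exists>r>0. \<exists>a::nat \<Rightarrow> real.
        \<forall>y. \<bar>y - x\<bar> < r \<longrightarrow> (\<lambda>n. a n * (y - x) ^ n) sums g y)"

definition analytic_near_nonneg :: "(real \<Rightarrow> real) \<Rightarrow> bool" where
  "analytic_near_nonneg g \<longleftrightarrow> (\<exists>U. open U \<and> {0..} \<subseteq> U \<and> real_analytic_on g U)"

definition smooth_on :: "real set \<Rightarrow> (real \<Rightarrow> real) \<Rightarrow> bool" where
  "smooth_on S g \<longleftrightarrow> (\<forall>k::nat. \<forall>x\<in>S. ((deriv ^^ k) g) differentiable (at x))"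

definition S_fun :: "real \<Rightarrow> (real \<Rightarrow> real) \<Rightarrow> ennreal" where
  "S_fun x0 lam = (\<integral>\<^sup>+ x. indicator {x0..} x *
      ennreal (lam x0 / lam x * (x / x0) powr (x0 * deriv lam x0 / lam x0)) \<partial>lborel)"

definition Mp :: "real \<Rightarrow> real \<Rightarrow> (complex \<Rightarrow> complex) \<Rightarrow> real" where
  "Mp p r f = (integral {0..2*pi} (\<lambda>\<theta>. norm (f (of_real r * exp (\<i> * of_real \<theta>))) powr p)) powr (1 / p)"

(* D_p(\<infinity>,f;\<omega>)^p, as an extended nonnegative real (integrand is \<ge> 0 since \<omega>' \<le> 0) *)
definition Dp_pow :: "real \<Rightarrow> (complex \<Rightarrow> complex) \<Rightarrow> (real \<Rightarrow> real) \<Rightarrow> ennreal" where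
  "Dp_pow p f \<omega> = (\<integral>\<^sup>+ z. ennreal (- (norm z ^ 2 * norm (f z) powr p * deriv \<omega> (norm z ^ 2))) \<partial>lborel)"

end

theory Submission
  imports Defs "HOL-Complex_Analysis.Complex_Analysis"
begin

text \<open>
  Write \<open>I(r) = M\<^sub>p(r, f)\<^sup>p\<close> and \<open>h(r) = r\<^sup>3 I(r) / \<lambda>(r)\<close>. In polar coordinates the hypothesis on \<open>D\<^sub>p\<close>
  says that \<open>h\<close> is integrable on \<open>[0, \<infinity>)\<close>. If \<open>h\<close> did not tend to 0, it would have local maxima
  \<open>x\<^sub>0\<close>, arbitrarily far out, with \<open>h(x\<^sub>0) \<ge> \<epsilon>\<close>. By Hardy's convexity theorem \<open>log (r\<^sup>3 I(r))\<close> is a convex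
  function of \<open>log r\<close>, and at \<open>x\<^sub>0\<close> its slope is \<open>m = x\<^sub>0 \<lambda>'(x\<^sub>0) / \<lambda>(x\<^sub>0)\<close>; hence
  \<open>h(x) \<ge> h(x\<^sub>0) \<lambda>(x\<^sub>0) / \<lambda>(x) (x / x\<^sub>0)\<^sup>m\<close> for \<open>x \<ge> x\<^sub>0\<close>, so the tail integral of \<open>h\<close> from \<open>x\<^sub>0\<close>
  is at least \<open>\<epsilon> S(x\<^sub>0, \<lambda>)\<close>, which stays away from 0. Finally \<open>C \<omega>(r\<^sup>2) \<le> 1 / \<lambda>(r)\<close>.
\<close>

section \<open>Polar coordinates\<close>

text \<open>Lebesgue measure is the only Borel measure giving each box its volume, and the preimage
  of a box under \<open>Complex\<close> is a rectangle. This opens complex area integrals to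
  Tonelli's theorem.\<close>

lemma distr_Complex_lborel:
  "distr (lborel \<Otimes>\<^sub>M lborel) borel (\<lambda>(x, y). Complex x y) = lborel"
proof (rule lborel_eqI[symmetric])
  have c: "continuous_on UNIV (\<lambda>(x::real, y). Complex x y)"
    unfolding case_prod_unfold Complex_eq by (intro continuous_intros)
  have [measurable]: "(\<lambda>(x, y). Complex x y) \<in> lborel \<Otimes>\<^sub>M lborel \<rightarrow>\<^sub>M borel"
    using borel_measurable_continuous_onI[OF c] by (simp add: lborel_prod)
  fix l u :: complex
  assume le: "\<And>b. b \<in> Basis \<Longrightarrow> l \<bullet> b \<le> u \<bullet> b"
  have le': "Re l \<le> Re u" "Im l \<le> Im u"
    using le[of 1] le[of \<i>] by (auto simp: Basis_complex_def)
  have "(\<lambda>(x, y). Complex x y) -` box l u = {Re l<..<Re u} \<times> {Im l<..<Im u}"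
    by (auto simp: box_def Basis_complex_def)
  then show "emeasure (distr (lborel \<Otimes>\<^sub>M lborel) borel (\<lambda>(x, y). Complex x y)) (box l u)
      = (\<Prod>b\<in>Basis. (u - l) \<bullet> b)"
    using le'
    by (simp add: emeasure_distr space_pair_measure
        lborel.emeasure_pair_measure_Times Basis_complex_def ennreal_mult)
qed simp

text \<open>Both orders of integration are recorded because the two kinds of shear below act on
  different coordinates.\<close>

lemma nn_integral_complex_lborel:
  assumes [measurable]: "\<Phi> \<in> borel_measurable borel"
  shows "(\<integral>\<^sup>+ z. \<Phi> z \<partial>lborel) = (\<integral>\<^sup>+ x. \<integral>\<^sup>+ y. \<Phi> (Complex x y) \<partial>lborel \<partial>lborel)"
    and "(\<integral>\<^sup>+ z. \<Phi> z \<partial>lborel) = (\<integral>\<^sup>+ y. \<integral>\<^sup>+ x. \<Phi> (Complex x y) \<partial>lborel \<partial>lborel)"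
proof -
  have c: "continuous_on UNIV (\<lambda>(x::real, y). Complex x y)"
    unfolding case_prod_unfold Complex_eq by (intro continuous_intros)
  have [measurable]: "(\<lambda>(x, y). Complex x y) \<in> lborel \<Otimes>\<^sub>M lborel \<rightarrow>\<^sub>M borel"
    using borel_measurable_continuous_onI[OF c] by (simp add: lborel_prod)
  have "(\<integral>\<^sup>+ z. \<Phi> z \<partial>lborel) = (\<integral>\<^sup>+ q. \<Phi> (case q of (x, y) \<Rightarrow> Complex x y) \<partial>(lborel \<Otimes>\<^sub>M lborel))"
    by (subst distr_Complex_lborel[symmetric], subst nn_integral_distr) auto
  also have eq: "\<dots> = (\<integral>\<^sup>+ x. \<integral>\<^sup>+ y. \<Phi> (Complex x y) \<partial>lborel \<partial>lborel)"
    by (subst lborel.nn_integral_fst[symmetric]) auto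
  finally show "(\<integral>\<^sup>+ z. \<Phi> z \<partial>lborel) = (\<integral>\<^sup>+ x. \<integral>\<^sup>+ y. \<Phi> (Complex x y) \<partial>lborel \<partial>lborel)" .
  then show "(\<integral>\<^sup>+ z. \<Phi> z \<partial>lborel) = (\<integral>\<^sup>+ y. \<integral>\<^sup>+ x. \<Phi> (Complex x y) \<partial>lborel \<partial>lborel)"
    by (subst lborel_pair.Fubini') auto
qed

text \<open>Once \<open>Im z\<close> is frozen the shear is a translation of the real line, so it
  disappears when the real part is integrated first.\<close>

lemma nn_integral_shear_Re:
  assumes [measurable]: "\<Phi> \<in> borel_measurable borel"
  shows "(\<integral>\<^sup>+ z. \<Phi> (z + of_real (t * Im z)) \<partial>lborel) = (\<integral>\<^sup>+ z. \<Phi> z \<partial>lborel)"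
proof -
  have [measurable]: "(\<lambda>x. Complex x y) \<in> borel_measurable borel" for y
    unfolding Complex_eq by measurable
  have [measurable]: "(\<lambda>z. \<Phi> (z + of_real (t * Im z))) \<in> borel_measurable borel"
    by measurable
  have "(\<integral>\<^sup>+ x. \<Phi> (Complex x y + of_real (t * y)) \<partial>lborel) = (\<integral>\<^sup>+ x. \<Phi> (Complex x y) \<partial>lborel)" for y
    by (subst (2) nn_integral_real_affine[where c = 1 and t = "t * y"])
       (auto simp: Complex_eq algebra_simps)
  then show ?thesis
    by (simp add: nn_integral_complex_lborel(2))
qed

lemma nn_integral_shear_Im:
  assumes [measurable]: "\<Phi> \<in> borel_measurable borel"
  shows "(\<integral>\<^sup>+ z. \<Phi> (z + \<i> * of_real (t * Re z)) \<partial>lborel) = (\<integral>\<^sup>+ z. \<Phi> z \<partial>lborel)"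
proof -
  have [measurable]: "(\<lambda>y. Complex x y) \<in> borel_measurable borel" for x
    unfolding Complex_eq by measurable
  have [measurable]: "(\<lambda>z. \<Phi> (z + \<i> * of_real (t * Re z))) \<in> borel_measurable borel"
    by measurable
  have "(\<integral>\<^sup>+ y. \<Phi> (Complex x y + \<i> * of_real (t * x)) \<partial>lborel) = (\<integral>\<^sup>+ y. \<Phi> (Complex x y) \<partial>lborel)" for x
    by (subst (2) nn_integral_real_affine[where c = 1 and t = "t * x"])
       (auto simp: Complex_eq algebra_simps)
  then show ?thesis
    by (simp add: nn_integral_complex_lborel(1))
qed

text \<open>A rotation by an angle \<open>\<theta> \<noteq> \<pi>\<close> is a product of three shears, with parameters
  \<open>-tan (\<theta>/2)\<close>, \<open>sin \<theta>\<close>, \<open>-tan (\<theta>/2)\<close>.\<close>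

lemma nn_integral_rotate:
  assumes [measurable]: "\<Phi> \<in> borel_measurable borel" and nz: "cos (\<theta> / 2) \<noteq> 0"
  shows "(\<integral>\<^sup>+ z. \<Phi> (z * cis \<theta>) \<partial>lborel) = (\<integral>\<^sup>+ z. \<Phi> z \<partial>lborel)"
proof -
  define t where "t = - tan (\<theta> / 2)"
  define s where "s = sin \<theta>"
  define A where "A = (\<lambda>z. z + complex_of_real (t * Im z))"
  define B where "B = (\<lambda>z. z + \<i> * complex_of_real (s * Re z))"
  have [measurable]: "A \<in> borel_measurable borel" "B \<in> borel_measurable borel"
    unfolding A_def B_def by measurable
  have s: "s = 2 * sin (\<theta>/2) * cos (\<theta>/2)" unfolding s_def using sin_double[of "\<theta>/2"] by simp
  have c: "cos \<theta> = 1 - 2 * (sin (\<theta>/2))\<^sup>2" using cos_double_sin[of "\<theta>/2"] by simp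
  \<comment> \<open>The matrix of \<open>A\<close> after \<open>B\<close> after \<open>A\<close> has
    diagonal entries \<open>1 + t * s\<close> and off-diagonal entries \<open>s\<close> and
    \<open>t * (2 + t * s)\<close>. With \<open>tc\<close> below, half-angle identities turn it into
    the rotation matrix.\<close>
  have ts: "1 + t * s = cos \<theta>"
    using nz by (simp add: t_def s c tan_def field_simps power2_eq_square)
  have sq: "(sin (\<theta>/2))\<^sup>2 = 1 - (cos (\<theta>/2))\<^sup>2" by (simp add: sin_squared_eq)
  have "1 + cos \<theta> = 2 * (cos (\<theta>/2))\<^sup>2" by (simp add: c sq)
  then have tc: "t * (1 + cos \<theta>) = - sin \<theta>"
    using nz by (simp add: t_def tan_def s[unfolded s_def] power2_eq_square)
  have ABA: "A (B (A z)) = z * cis \<theta>" for z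
  proof (rule complex_eqI)
    have "Re (A (B (A z))) = (1 + t * s) * Re z + t * (1 + (1 + t * s)) * Im z"
      by (simp add: A_def B_def algebra_simps)
    then show "Re (A (B (A z))) = Re (z * cis \<theta>)"
      by (simp only: ts tc) (simp add: algebra_simps)
    have "Im (A (B (A z))) = s * Re z + (1 + t * s) * Im z"
      by (simp add: A_def B_def algebra_simps)
    then show "Im (A (B (A z))) = Im (z * cis \<theta>)"
      by (simp only: ts) (simp add: s_def algebra_simps)
  qed
  have "(\<integral>\<^sup>+ z. \<Phi> z \<partial>lborel) = (\<integral>\<^sup>+ z. \<Phi> (A z) \<partial>lborel)"
    unfolding A_def by (rule nn_integral_shear_Re[symmetric]) simp
  also have "\<dots> = (\<integral>\<^sup>+ z. \<Phi> (A (B z)) \<partial>lborel)"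
    unfolding B_def by (rule nn_integral_shear_Im[of "\<lambda>z. \<Phi> (A z)", symmetric]) simp
  also have "\<dots> = (\<integral>\<^sup>+ z. \<Phi> (A (B (A z))) \<partial>lborel)"
    by (subst (3) A_def, rule nn_integral_shear_Re[of "\<lambda>z. \<Phi> (A (B z))", symmetric]) simp
  finally show ?thesis by (simp add: ABA)
qed

text \<open>On the half-lines \<open>{..a}\<close>, an intersection-stable generator, both measures
  give the area of the disc of radius \<open>a\<close>, or 0 for negative \<open>a\<close>.\<close>

lemma distr_norm_lborel_complex:
  "distr lborel borel (norm :: complex \<Rightarrow> real)
    = density lborel (\<lambda>r. ennreal (2 * pi * r) * indicator {0..} r)" (is "?M = ?N")
proof (rule measure_eqI_generator_eq[where E = "range (\<lambda>a. {..a::real})" and \<Omega> = UNIV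
      and A = "\<lambda>i::nat. {..real i}"])
  show "Int_stable (range (\<lambda>a. {..a::real}))"
    by (auto simp: Int_stable_def)
  show "sets ?M = sigma_sets UNIV (range (\<lambda>a. {..a::real}))"
    by (simp add: borel_eq_atMost)
  show "sets ?N = sigma_sets UNIV (range (\<lambda>a. {..a::real}))"
    by (simp add: borel_eq_atMost)
  have M: "emeasure ?M {..a} = ennreal (if a \<ge> 0 then pi * a\<^sup>2 else 0)" for a
  proof -
    have "norm -` {..a} = cball (0::complex) a" by auto
    then show ?thesis
      by (auto simp: emeasure_distr emeasure_cball unit_ball_vol_2 cball_empty simp del: atMost_iff)
  qed
  have N: "emeasure ?N {..a} = ennreal (if a \<ge> 0 then pi * a\<^sup>2 else 0)" for a
  proof (cases "a \<ge> 0")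
    case True
    have "emeasure ?N {..a} = (\<integral>\<^sup>+ r. ennreal (2 * pi * r) * indicator {0..a} r \<partial>lborel)"
      by (subst emeasure_density) (auto intro!: nn_integral_cong split: split_indicator)
    also have "\<dots> = pi * a\<^sup>2 - pi * 0\<^sup>2"
      using True by (intro nn_integral_FTC_Icc) (auto intro!: derivative_eq_intros)
    finally show ?thesis using True by simp
  next
    case False
    have "emeasure ?N {..a} = (\<integral>\<^sup>+ r. ennreal (2 * pi * r) * indicator {0..} r * indicator {..a} r \<partial>lborel)"
      by (subst emeasure_density) auto
    also have "\<dots> = (\<integral>\<^sup>+ r. 0 \<partial>(lborel :: real measure))"
      using False by (intro nn_integral_cong) (auto split: split_indicator)
    finally have "emeasure ?N {..a} = 0" by simp
    then show ?thesis using False by simp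
  qed
  show "emeasure ?M X = emeasure ?N X" if "X \<in> range (\<lambda>a. {..a::real})" for X
    using that M N by auto
  show "(\<Union>i::nat. {..real i}) = UNIV"
    using real_arch_simple by auto
  show "emeasure ?M {..real i} \<noteq> \<infinity>" for i
    by (simp add: M)
qed auto

text \<open>The shifted window \<open>{a..a+T}\<close> is cut at \<open>T\<close> and the part
  beyond it is moved back by one period. The pieces overlap in single points, which are null
  sets.\<close>

lemma nn_integral_periodic_shift:
  fixes g :: "real \<Rightarrow> ennreal"
  assumes [measurable]: "g \<in> borel_measurable borel"
    and per: "\<And>x. g (x + T) = g x" and a: "0 \<le> a" "a \<le> T"
  shows "(\<integral>\<^sup>+ x. g (x + a) * indicator {0..T} x \<partial>lborel) = (\<integral>\<^sup>+ x. g x * indicator {0..T} x \<partial>lborel)"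
proof -
  have ae: "AE x in lborel. x \<noteq> c" for c :: real
    by (rule AE_lborel_singleton)
  have "(\<integral>\<^sup>+ x. g x * indicator {a..a+T} x \<partial>lborel)
      = (\<integral>\<^sup>+ x. g (x + a) * indicator {0..T} x \<partial>lborel)"
    by (subst nn_integral_real_affine[where c = 1 and t = a])
       (auto intro!: nn_integral_cong simp: add.commute split: split_indicator)
  moreover have "(\<integral>\<^sup>+ x. g x * indicator {a..a+T} x \<partial>lborel)
      = (\<integral>\<^sup>+ x. g x * indicator {a..T} x + g x * indicator {T..a+T} x \<partial>lborel)"
    by (rule nn_integral_cong_AE, use ae[of T] in eventually_elim) (use a in \<open>auto split: split_indicator\<close>)
  moreover have "\<dots> = (\<integral>\<^sup>+ x. g x * indicator {a..T} x \<partial>lborel) + (\<integral>\<^sup>+ x. g x * indicator {T..a+T} x \<partial>lborel)"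
    by (rule nn_integral_add) auto
  moreover have "(\<integral>\<^sup>+ x. g x * indicator {T..a+T} x \<partial>lborel) = (\<integral>\<^sup>+ x. g x * indicator {0..a} x \<partial>lborel)"
    by (subst nn_integral_real_affine[where c = 1 and t = T])
       (auto intro!: nn_integral_cong simp: per add.commute[of T] split: split_indicator)
  moreover have "(\<integral>\<^sup>+ x. g x * indicator {a..T} x \<partial>lborel) + (\<integral>\<^sup>+ x. g x * indicator {0..a} x \<partial>lborel)
      = (\<integral>\<^sup>+ x. g x * indicator {a..T} x + g x * indicator {0..a} x \<partial>lborel)"
    by (rule nn_integral_add[symmetric]) auto
  moreover have "\<dots> = (\<integral>\<^sup>+ x. g x * indicator {0..T} x \<partial>lborel)"
    by (rule nn_integral_cong_AE, use ae[of a] in eventually_elim) (use a in \<open>auto split: split_indicator\<close>)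
  ultimately show ?thesis by simp
qed

text \<open>Multiplying by the phase of \<open>z\<close> only shifts the angle, and the integrand
  has period \<open>2*pi\<close>.\<close>

lemma nn_integral_circle_norm:
  assumes [measurable]: "\<Phi> \<in> borel_measurable borel"
  shows "(\<integral>\<^sup>+ \<theta>. \<Phi> (z * cis \<theta>) * indicator {0..2*pi} \<theta> \<partial>lborel)
    = (\<integral>\<^sup>+ \<theta>. \<Phi> (of_real (norm z) * cis \<theta>) * indicator {0..2*pi} \<theta> \<partial>lborel)"
proof -
  define a where "a = Arg2pi z"
  have z: "z = of_real (norm z) * cis a"
    using Arg2pi_eq[of z] by (simp add: a_def cis_conv_exp)
  have [measurable]: "cis \<in> borel_measurable borel"
    by (intro borel_measurable_continuous_onI continuous_intros)
  have "(\<integral>\<^sup>+ \<theta>. \<Phi> (of_real (norm z) * cis (\<theta> + a)) * indicator {0..2*pi} \<theta> \<partial>lborel)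
      = (\<integral>\<^sup>+ \<theta>. \<Phi> (of_real (norm z) * cis \<theta>) * indicator {0..2*pi} \<theta> \<partial>lborel)"
    using Arg2pi_ge_0[of z] Arg2pi_lt_2pi[of z]
    by (intro nn_integral_periodic_shift[where g = "\<lambda>\<theta>. \<Phi> (of_real (norm z) * cis \<theta>)"])
       (auto simp: a_def cis_mult[symmetric])
  moreover have "of_real (norm z) * cis (\<theta> + a) = z * cis \<theta>" for \<theta>
    by (subst (2) z) (simp add: cis_mult[symmetric] mult_ac)
  ultimately show ?thesis by simp
qed

text \<open>No Jacobian is computed. The integral is averaged over all rotations, the order is
  exchanged by Tonelli, and the angular integral then depends on \<open>norm z\<close> alone, whose
  distribution is known.\<close>

lemma nn_integral_polar:
  assumes [measurable]: "\<Phi> \<in> borel_measurable borel"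
  shows "(\<integral>\<^sup>+ z. \<Phi> z \<partial>lborel)
    = (\<integral>\<^sup>+ r. ennreal r * indicator {0..} r *
         (\<integral>\<^sup>+ \<theta>. \<Phi> (of_real r * cis \<theta>) * indicator {0..2*pi} \<theta> \<partial>lborel) \<partial>lborel)"
proof -
  have [measurable]: "cis \<in> borel_measurable borel"
    by (intro borel_measurable_continuous_onI continuous_intros)
  define J where "J r = (\<integral>\<^sup>+ \<theta>. \<Phi> (of_real r * cis \<theta>) * indicator {0..2*pi} \<theta> \<partial>lborel)" for r
  have [measurable]: "J \<in> borel_measurable borel"
    unfolding J_def by measurable
  \<comment> \<open>The half turn is left out because the shear parameter
    \<open>tan (\<theta> / 2)\<close> is singular there; one angle is a null set in the
    average.\<close>
  have rot: "(\<integral>\<^sup>+ z. \<Phi> (z * cis \<theta>) \<partial>lborel) = (\<integral>\<^sup>+ z. \<Phi> z \<partial>lborel)"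
    if "\<theta> \<noteq> pi" "\<theta> \<in> {0..2*pi}" for \<theta>
  proof (rule nn_integral_rotate)
    show "cos (\<theta> / 2) \<noteq> 0"
    proof
      assume "cos (\<theta> / 2) = 0"
      moreover have "cos (pi / 2) = 0" by simp
      ultimately have "\<theta> / 2 = pi / 2"
        using that by - (rule cos_inj_pi, auto)
      then show False using that by simp
    qed
  qed simp
  have "ennreal (2 * pi) * (\<integral>\<^sup>+ z. \<Phi> z \<partial>lborel)
      = (\<integral>\<^sup>+ \<theta>. (\<integral>\<^sup>+ z. \<Phi> z \<partial>lborel) * indicator {0..2*pi} \<theta> \<partial>(lborel :: real measure))"
    by (subst nn_integral_cmult_indicator) (auto simp: mult.commute)
  also have "\<dots> = (\<integral>\<^sup>+ \<theta>. (\<integral>\<^sup>+ z. \<Phi> (z * cis \<theta>) * indicator {0..2*pi} \<theta> \<partial>lborel) \<partial>lborel)"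
    by (rule nn_integral_cong_AE, use AE_lborel_singleton[of pi] in eventually_elim)
       (auto simp: rot nn_integral_multc split: split_indicator)
  also have "\<dots> = (\<integral>\<^sup>+ z. (\<integral>\<^sup>+ \<theta>. \<Phi> (z * cis \<theta>) * indicator {0..2*pi} \<theta> \<partial>lborel) \<partial>lborel)"
    by (rule lborel_pair.Fubini') auto
  also have "\<dots> = (\<integral>\<^sup>+ z. J (norm (z :: complex)) \<partial>lborel)"
    unfolding J_def by (intro nn_integral_cong nn_integral_circle_norm) simp
  also have "\<dots> = (\<integral>\<^sup>+ r. J r \<partial>(distr lborel borel (norm :: complex \<Rightarrow> real)))"
    by (subst nn_integral_distr) auto
  also have "\<dots> = (\<integral>\<^sup>+ r. ennreal (2 * pi * r) * indicator {0..} r * J r \<partial>lborel)"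
    unfolding distr_norm_lborel_complex by (subst nn_integral_density) auto
  also have "\<dots> = (\<integral>\<^sup>+ r. ennreal (2 * pi) * (ennreal r * indicator {0..} r * J r) \<partial>lborel)"
    by (intro nn_integral_cong) (auto simp: ennreal_mult mult_ac split: split_indicator)
  also have "\<dots> = ennreal (2 * pi) * (\<integral>\<^sup>+ r. ennreal r * indicator {0..} r * J r \<partial>lborel)"
    by (subst nn_integral_cmult) auto
  finally show ?thesis
    by (simp add: ennreal_mult_cancel_left J_def)
qed

section \<open>Hardy's convexity theorem\<close>

lemma nn_integral_Icc_eq_integral:
  fixes g :: "real \<Rightarrow> real"
  assumes g: "continuous_on {a..b} g" "\<And>x. x \<in> {a..b} \<Longrightarrow> 0 \<le> g x"
  shows "(\<integral>\<^sup>+ x. ennreal (g x) * indicator {a..b} x \<partial>lborel) = ennreal (integral {a..b} g)"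
proof -
  have "(g has_integral integral {a..b} g) {a..b}"
    using g by (intro integrable_integral integrable_continuous_interval)
  then have "((\<lambda>x. indicator {a..b} x * g x) has_integral integral {a..b} g) UNIV"
    by (subst (asm) has_integral_restrict_UNIV[symmetric])
       (auto elim!: has_integral_eq[rotated] split: split_indicator)
  moreover have "(\<lambda>x. indicator {a..b} x * g x) \<in> borel_measurable borel"
    using borel_measurable_continuous_on_indicator[OF _ g(1)] by simp
  ultimately have "(\<integral>\<^sup>+ x. ennreal (indicator {a..b} x * g x) \<partial>lborel) = ennreal (integral {a..b} g)"
    using g by (intro nn_integral_has_integral_lborel) (auto split: split_indicator)
  then show ?thesis
    by (subst (asm) nn_integral_cong[where v = "\<lambda>x. ennreal (g x) * indicator {a..b} x"])
       (auto split: split_indicator)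
qed

text \<open>A power of \<open>z\<close> with real exponent is multivalued on the annulus, but its
  modulus is not. Pulling back along \<open>exp\<close> to a strip gives a single-valued holomorphic
  function with the modulus in question, to which the maximum modulus principle applies.\<close>

lemma maximum_principle_annulus:
  assumes F: "F holomorphic_on UNIV" and r: "0 < r1" "r1 < r2"
    and bd: "\<And>z. norm z = r1 \<or> norm z = r2 \<Longrightarrow> norm z powr \<beta> * norm (F z) \<le> B"
    and z: "r1 \<le> norm z" "norm z \<le> r2"
  shows "norm z powr \<beta> * norm (F z) \<le> B"
proof -
  define A where "A = cball 0 r2 - ball (0::complex) r1"
  have "compact A" unfolding A_def by (intro compact_diff) auto
  moreover have "z \<in> A" using z by (auto simp: A_def)
  moreover have "continuous_on A (\<lambda>z. norm z powr \<beta> * norm (F z))"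
    using r by (intro continuous_intros holomorphic_on_imp_continuous_on holomorphic_on_subset[OF F])
       (auto simp: A_def)
  ultimately obtain z0 where z0: "z0 \<in> A"
    and mx: "\<And>z. z \<in> A \<Longrightarrow> norm z powr \<beta> * norm (F z) \<le> norm z0 powr \<beta> * norm (F z0)"
    using continuous_attains_sup[of A "\<lambda>z. norm z powr \<beta> * norm (F z)"] by blast
  have "norm z0 powr \<beta> * norm (F z0) \<le> B"
  proof (cases "norm z0 = r1 \<or> norm z0 = r2")
    case True
    then show ?thesis by (rule bd)
  next
    case False
    then have z0': "r1 < norm z0" "norm z0 < r2" using z0 by (auto simp: A_def)
    define G where "G w = exp (of_real \<beta> * w) * F (exp w)" for w
    have nG: "norm (G w) = norm (exp w) powr \<beta> * norm (F (exp w))" for w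
      by (simp add: G_def norm_mult powr_def)
    have hol: "G holomorphic_on T" for T
      unfolding G_def
      by (intro holomorphic_intros holomorphic_on_compose_gen[OF _ F, unfolded o_def]) auto
    define S where "S = {w. ln r1 < Re w} \<inter> {w. Re w < ln r2}"
    have S: "open S" "convex S"
      unfolding S_def by (auto intro: open_halfspace_Re_gt open_halfspace_Re_lt
          convex_Int convex_halfspace_Re_gt convex_halfspace_Re_lt)
    have w0: "Ln z0 \<in> S" "exp (Ln z0) = z0"
      using z0' r by (auto simp: S_def simp flip: norm_le_zero_iff)
    have "G constant_on S"
    proof (rule maximum_modulus_principle[OF hol S(1) convex_connected[OF S(2)] S(1) order_refl w0(1)])
      fix w assume "w \<in> S"
      then have "exp w \<in> A"
        using r exp_less_mono[of "ln r1" "Re w"] exp_less_mono[of "Re w" "ln r2"]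
        by (simp add: S_def A_def norm_exp_eq_Re)
      then show "norm (G w) \<le> norm (G (Ln z0))"
        using mx[of "exp w"] by (simp add: nG w0 del: norm_exp_eq_Re)
    qed
    then obtain c where c: "\<And>w. w \<in> S \<Longrightarrow> G w = c"
      by (auto simp: constant_on_def)
    \<comment> \<open>\<open>G\<close> is so far constant only on the open strip. Continuity carries
      the constant to the boundary line over the circle of radius \<open>r1\<close>, where
      \<open>bd\<close> applies.\<close>
    have "isCont G (of_real (ln r1))"
      using hol[of UNIV] by (meson UNIV_I continuous_on_eq_continuous_at holomorphic_on_imp_continuous_on open_UNIV)
    moreover have "((\<lambda>x. complex_of_real x) \<longlongrightarrow> of_real (ln r1)) (at_right (ln r1))"
      by (intro tendsto_intros)
    ultimately have "((\<lambda>x. G (of_real x)) \<longlongrightarrow> G (of_real (ln r1))) (at_right (ln r1))"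
      by (rule isCont_tendsto_compose)
    moreover have "ln r1 < ln r2" using r by simp
    then have "\<forall>\<^sub>F x in at_right (ln r1). G (of_real x) = c"
      unfolding eventually_at_right_field by (intro exI[of _ "ln r2"]) (auto intro!: c simp: S_def)
    ultimately have "((\<lambda>x. c) \<longlongrightarrow> G (of_real (ln r1))) (at_right (ln r1))"
      by (rule Lim_transform_eventually)
    then have "G (of_real (ln r1)) = c"
      by (simp add: tendsto_const_iff)
    then have "norm (G (Ln z0)) = norm (G (of_real (ln r1)))"
      using c[OF w0(1)] by simp
    also have "\<dots> \<le> B"
      unfolding nG using r by (intro bd) (simp add: norm_exp_eq_Re)
    finally show ?thesis by (simp add: nG w0)
  qed
  then show ?thesis using mx[OF \<open>z \<in> A\<close>] by linarith
qed

text \<open>This is the \<open>p\<close>-th power of \<open>Mp p r f\<close>.\<close>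

definition circle_mean :: "real \<Rightarrow> (complex \<Rightarrow> complex) \<Rightarrow> real \<Rightarrow> real" where
  "circle_mean p f r = integral {0..2*pi} (\<lambda>\<theta>. norm (f (of_real r * cis \<theta>)) powr p)"

section \<open>Integral means of an entire function and the three circles inequality\<close>

context
  fixes f :: "complex \<Rightarrow> complex" and p :: real
  assumes f: "f holomorphic_on UNIV" and p: "1 < p"
begin

lemma continuous_on_entire_comp:
  "continuous_on S h \<Longrightarrow> continuous_on S (\<lambda>x. f (h x))"
  using continuous_on_compose2[OF holomorphic_on_imp_continuous_on[OF f]] by auto

lemma continuous_on_norm_powr:
  "continuous_on S h \<Longrightarrow> continuous_on S (\<lambda>x. norm (f (h x)) powr p)"
  using p by (intro continuous_on_powr' continuous_intros continuous_on_entire_comp) auto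

lemma circle_mean_nonneg: "0 \<le> circle_mean p f r"
  unfolding circle_mean_def by (intro integral_nonneg) 
    (auto intro!: integrable_continuous_interval continuous_on_norm_powr continuous_intros)

lemma nn_integral_circle:
  "(\<integral>\<^sup>+ \<theta>. ennreal (norm (f (of_real r * cis \<theta>)) powr p) * indicator {0..2*pi} \<theta> \<partial>lborel)
    = ennreal (circle_mean p f r)"
  unfolding circle_mean_def
  by (intro nn_integral_Icc_eq_integral continuous_on_norm_powr continuous_intros) auto

text \<open>The maximum principle needs bounds at all points of the boundary circles, not only at
  positive reals; this supplies the mean for any starting angle.\<close>

lemma circle_mean_rotate:
  "integral {0..2*pi} (\<lambda>\<theta>. norm (f (z * cis \<theta>)) powr p) = circle_mean p f (norm z)"
proof -
  have "(\<lambda>z. norm (f z) powr p) \<in> borel_measurable borel"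
    by (intro borel_measurable_continuous_onI continuous_on_norm_powr continuous_intros)
  then have "(\<integral>\<^sup>+ \<theta>. ennreal (norm (f (z * cis \<theta>)) powr p) * indicator {0..2*pi} \<theta> \<partial>lborel)
      = ennreal (circle_mean p f (norm z))"
    using nn_integral_circle_norm[of "\<lambda>z. ennreal (norm (f z) powr p)" z] nn_integral_circle[of "norm z"]
    by simp
  moreover have "(\<integral>\<^sup>+ \<theta>. ennreal (norm (f (z * cis \<theta>)) powr p) * indicator {0..2*pi} \<theta> \<partial>lborel)
      = ennreal (integral {0..2*pi} (\<lambda>\<theta>. norm (f (z * cis \<theta>)) powr p))"
    by (intro nn_integral_Icc_eq_integral continuous_on_norm_powr continuous_intros) auto
  moreover have "0 \<le> integral {0..2*pi} (\<lambda>\<theta>. norm (f (z * cis \<theta>)) powr p)"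
    by (intro integral_nonneg)
       (auto intro!: integrable_continuous_interval continuous_on_norm_powr continuous_intros)
  ultimately show ?thesis
    using circle_mean_nonneg by simp
qed

lemma continuous_on_circle_mean: "continuous_on S (circle_mean p f)"
proof -
  have "continuous_on (S \<times> cbox 0 (2*pi)) (\<lambda>(r, \<theta>). norm (f (of_real r * cis \<theta>)) powr p)"
    unfolding case_prod_unfold by (intro continuous_on_norm_powr continuous_intros)
  then show ?thesis
    unfolding circle_mean_def[abs_def] box_real(2)[symmetric] by (rule integral_continuous_on_param)
qed

text \<open>Differentiation under the integral sign. The weight \<open>g\<close> need not be
  holomorphic, so it may contain conjugates and moduli of \<open>f\<close>.\<close>

lemma holomorphic_circle_convolution:
  assumes g: "continuous_on {0..2*pi} g"
  shows "(\<lambda>z. integral {0..2*pi} (\<lambda>\<theta>. f (z * cis \<theta>) * g \<theta>)) holomorphic_on UNIV"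
proof -
  have "(\<lambda>z. integral (cbox 0 (2*pi)) (\<lambda>\<theta>. f (z * cis \<theta>) * g \<theta>)) holomorphic_on UNIV"
  proof (rule leibniz_rule_holomorphic)
    show "((\<lambda>z. f (z * cis \<theta>) * g \<theta>) has_field_derivative deriv f (z * cis \<theta>) * cis \<theta> * g \<theta>) (at z within UNIV)" 
      for z \<theta>
    proof -
      have "(f has_field_derivative deriv f (z * cis \<theta>)) (at (z * cis \<theta>))"
        using f by (auto intro: holomorphic_derivI)
      then show ?thesis
        by (auto intro!: derivative_eq_intros DERIV_chain2[where f = f])
    qed
    show "(\<lambda>\<theta>. f (z * cis \<theta>) * g \<theta>) integrable_on cbox 0 (2*pi)" for z
      using g by (auto intro!: integrable_continuous_interval continuous_intros continuous_on_entire_comp)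
    have "continuous_on UNIV (deriv f)"
      using f by (intro holomorphic_on_imp_continuous_on holomorphic_deriv) auto
    moreover have "continuous_on (UNIV \<times> cbox 0 (2*pi)) (\<lambda>x. g (snd x))"
      by (rule continuous_on_compose2[OF g]) (auto intro!: continuous_intros)
    moreover have "continuous_on (UNIV \<times> cbox 0 (2*pi)) (\<lambda>x::complex \<times> real. deriv f (fst x * cis (snd x)))"
      by (rule continuous_on_compose2[OF calculation(1)]) (auto intro!: continuous_intros)
    ultimately show "continuous_on (UNIV \<times> cbox 0 (2*pi)) (\<lambda>(z, \<theta>). deriv f (z * cis \<theta>) * cis \<theta> * g \<theta>)"
      unfolding case_prod_unfold by (intro continuous_intros) auto
  qed auto
  then show ?thesis by simp
qed

lemma norm_cnj_powr: "norm (cnj w * of_real (norm w powr (p - 2))) = norm w powr (p - 1)"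
proof (cases "w = 0")
  case False
  have "norm (cnj w * of_real (norm w powr (p - 2))) = norm w powr 1 * norm w powr (p - 2)"
    by (simp add: norm_mult)
  also have "\<dots> = norm w powr (p - 1)"
    by (subst powr_add[symmetric]) simp
  finally show ?thesis .
qed simp

text \<open>This is the dual map: its product with \<open>w\<close> is \<open>norm w powr p\<close>.
  At 0 the factor \<open>norm w powr (p - 2)\<close> may blow up nearby, but the whole has modulus
  \<open>norm w powr (p - 1)\<close>, which tends to 0 because \<open>1 < p\<close>.\<close>

lemma continuous_on_cnj_powr: "continuous_on UNIV (\<lambda>w::complex. cnj w * of_real (norm w powr (p - 2)))"
  unfolding continuous_on_eq_continuous_at[OF open_UNIV]
proof
  fix w :: complex
  show "isCont (\<lambda>w. cnj w * of_real (norm w powr (p - 2))) w"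
  proof (cases "w = 0")
    case True
    have "((\<lambda>w::complex. norm w powr (p - 1)) \<longlongrightarrow> norm (0::complex) powr (p - 1)) (at 0)"
      using p by (intro tendsto_powr' tendsto_intros) auto
    then have "((\<lambda>w. cnj w * of_real (norm w powr (p - 2))) \<longlongrightarrow> 0) (at 0)"
      using p by (subst tendsto_norm_zero_iff[symmetric]) (simp only: norm_cnj_powr, simp)
    then show ?thesis using True by (simp add: isCont_def)
  next
    case False
    then show ?thesis by (intro continuous_intros) auto
  qed
qed

text \<open>The dual function of \<open>f\<close> on the circle of radius \<open>r0\<close> turns the integral mean into the value of
  an entire function, to which the maximum principle applies; Young's inequality takes the role of
  Hoelder's inequality.\<close>

lemma circle_mean_three_circles:
  assumes r: "0 < r1" "r1 \<le> r0" "r0 \<le> r2" "r1 < r2"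
    and K1: "r1 powr \<alpha> * circle_mean p f r1 \<le> K" and K2: "r2 powr \<alpha> * circle_mean p f r2 \<le> K"
  shows "r0 powr \<alpha> * circle_mean p f r0 \<le> K"
proof -
  define \<beta> where "\<beta> = \<alpha> / p"
  define X where "X = r0 powr \<alpha> * circle_mean p f r0"
  \<comment> \<open>This scaling makes \<open>norm (g \<theta>)\<close> equal to
    \<open>c \<theta> powr (p - 1)\<close>, where \<open>c \<theta> powr p\<close> integrates to
    \<open>X\<close>. It also gives \<open>r0 powr \<beta> * s = r0 powr \<alpha>\<close>.\<close>
  define s where "s = r0 powr (\<beta> * (p - 1))"
  define g where "g \<theta> = of_real s * (cnj (f (of_real r0 * cis \<theta>)) *
      of_real (norm (f (of_real r0 * cis \<theta>)) powr (p - 2)))" for \<theta>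
  define F where "F z = integral {0..2*pi} (\<lambda>\<theta>. f (z * cis \<theta>) * g \<theta>)" for z
  define c where "c \<theta> = r0 powr \<beta> * norm (f (of_real r0 * cis \<theta>))" for \<theta>
  have \<beta>p: "\<beta> * p = \<alpha>" using p by (simp add: \<beta>_def)
  have r0: "0 < r0" using r by simp
  have c0: "c \<theta> \<ge> 0" for \<theta> by (simp add: c_def)
  have cp: "c \<theta> powr p = r0 powr \<alpha> * norm (f (of_real r0 * cis \<theta>)) powr p" for \<theta>
    by (simp add: c_def powr_mult powr_powr \<beta>p)
  have g_cont: "continuous_on {0..2*pi} g"
    unfolding g_def
    by (intro continuous_intros continuous_on_compose2[OF continuous_on_cnj_powr] continuous_on_entire_comp) auto
  have hol: "F holomorphic_on UNIV"
    unfolding F_def by (rule holomorphic_circle_convolution[OF g_cont])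
  have ng: "norm (g \<theta>) = c \<theta> powr (p - 1)" for \<theta>
    unfolding g_def by (subst norm_mult, subst norm_cnj_powr)
      (simp add: c_def s_def powr_mult powr_powr)
  \<comment> \<open>Young's inequality with the conjugate exponent \<open>p / (p - 1)\<close>, which
    turns \<open>b powr (p - 1)\<close> into \<open>b powr p\<close>.\<close>
  have young: "a * b powr (p - 1) \<le> a powr p / p + (1 - 1 / p) * b powr p" if "a \<ge> 0" "b \<ge> 0" for a b
  proof -
    have "a * b powr (p - 1) \<le> a powr p / p + (b powr (p - 1)) powr (p / (p - 1)) / (p / (p - 1))"
      using p that by (intro Youngs_inequality) (auto simp: field_simps)
    also have "(b powr (p - 1)) powr (p / (p - 1)) = b powr p"
      using p by (simp add: powr_powr)
    finally show ?thesis using p by (simp add: field_simps)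
  qed
  have int_p: "(\<lambda>\<theta>. norm (f (z * cis \<theta>)) powr p) integrable_on {0..2*pi}" for z
    by (intro integrable_continuous_interval continuous_on_norm_powr continuous_intros)
  have bound: "norm z powr \<beta> * norm (F z) \<le> K / p + (1 - 1 / p) * X"
    if z: "norm z = r1 \<or> norm z = r2" for z
  proof -
    let ?b = "\<lambda>\<theta>. norm z powr \<alpha> / p * norm (f (z * cis \<theta>)) powr p
        + (1 - 1 / p) * r0 powr \<alpha> * norm (f (of_real r0 * cis \<theta>)) powr p"
    have "norm z powr \<beta> * norm (F z) = norm (integral {0..2*pi} (\<lambda>\<theta>. of_real (norm z powr \<beta>) * (f (z * cis \<theta>) * g \<theta>)))"
      by (simp add: F_def norm_mult)
    also have "\<dots> \<le> integral {0..2*pi} ?b"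
    proof (rule integral_norm_bound_integral)
      show "(\<lambda>\<theta>. of_real (norm z powr \<beta>) * (f (z * cis \<theta>) * g \<theta>)) integrable_on {0..2*pi}"
        by (intro integrable_continuous_interval continuous_intros g_cont continuous_on_entire_comp)
      show "?b integrable_on {0..2*pi}"
        by (intro integrable_add integrable_on_mult_right int_p)
      fix \<theta>
      have "norm (of_real (norm z powr \<beta>) * (f (z * cis \<theta>) * g \<theta>))
          = (norm z powr \<beta> * norm (f (z * cis \<theta>))) * c \<theta> powr (p - 1)"
        by (simp add: norm_mult ng)
      also have "\<dots> \<le> (norm z powr \<beta> * norm (f (z * cis \<theta>))) powr p / p + (1 - 1 / p) * c \<theta> powr p"
        using c0 by (intro young) auto
      also have "\<dots> = ?b \<theta>"
        by (simp add: cp powr_mult powr_powr \<beta>p)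
      finally show "norm (of_real (norm z powr \<beta>) * (f (z * cis \<theta>) * g \<theta>)) \<le> ?b \<theta>" .
    qed
    also have "\<dots> = norm z powr \<alpha> / p * circle_mean p f (norm z) + (1 - 1 / p) * r0 powr \<alpha> * circle_mean p f r0"
      using circle_mean_rotate[of z] circle_mean_rotate[of "of_real r0"] r0
      by (subst integral_add; (intro integrable_on_mult_right int_p)?) simp
    also have "\<dots> = norm z powr \<alpha> * circle_mean p f (norm z) / p + (1 - 1 / p) * X"
      by (simp add: X_def)
    also have "\<dots> \<le> K / p + (1 - 1 / p) * X"
      using p K1 K2 z by (intro add_right_mono divide_right_mono) auto
    finally show ?thesis .
  qed
  have "norm (complex_of_real r0) powr \<beta> * norm (F (of_real r0)) \<le> K / p + (1 - 1 / p) * X"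
    using r by (intro maximum_principle_annulus[OF hol r(1) r(4) bound]) auto
  moreover have "norm (complex_of_real r0) powr \<beta> * norm (F (of_real r0)) = X"
  proof -
    \<comment> \<open>At \<open>r0\<close> the product with the dual function is real and
      nonnegative, so no cancellation occurs and \<open>F\<close> reproduces the mean
      exactly.\<close>
    have fg: "f (of_real r0 * cis \<theta>) * g \<theta> = of_real (s * norm (f (of_real r0 * cis \<theta>)) powr p)" for \<theta>
    proof (cases "f (of_real r0 * cis \<theta>) = 0")
      case False
      let ?w = "f (of_real r0 * cis \<theta>)"
      have "?w * g \<theta> = of_real s * (of_real ((norm ?w)\<^sup>2) * of_real (norm ?w powr (p - 2)))"
        by (simp add: g_def mult_ac complex_norm_square del: of_real_power)
      also have "(norm ?w)\<^sup>2 = norm ?w powr 2"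
        by simp
      also have "complex_of_real s * (of_real (norm ?w powr 2) * of_real (norm ?w powr (p - 2)))
          = of_real (s * (norm ?w powr 2 * norm ?w powr (p - 2)))"
        by simp
      also have "norm ?w powr 2 * norm ?w powr (p - 2) = norm ?w powr p"
        by (subst powr_add[symmetric]) simp
      finally show ?thesis .
    qed simp
    have "F (of_real r0) = of_real (s * circle_mean p f r0)"
      unfolding F_def fg circle_mean_def
      using integral_linear[OF integrable_on_mult_right[OF int_p, of s "of_real r0"] bounded_linear_of_real[where 'a = complex]]
      by (simp add: o_def)
    then have "norm (F (of_real r0)) = s * circle_mean p f r0"
      using circle_mean_nonneg by (simp add: norm_mult s_def)
    moreover have "r0 powr \<beta> * s = r0 powr \<alpha>"
      unfolding s_def \<beta>p[symmetric] by (subst powr_add[symmetric]) (simp add: algebra_simps)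
    ultimately show ?thesis
      using r0 by (simp add: X_def)
  qed
  \<comment> \<open>\<open>X\<close> occurs on both sides, but with the factor
    \<open>1 - 1 / p\<close> below 1 on the right, so it can be absorbed.\<close>
  ultimately have "X \<le> K / p + (1 - 1 / p) * X" by simp
  then have "X \<le> K"
    using p by (simp add: field_simps)
  then show ?thesis by (simp add: X_def)
qed

end

section \<open>Local maxima of the weighted means\<close>

text \<open>Log-convexity turns the tangency of \<open>r\<^sup>k I(r)\<close> and \<open>lam\<close> at a local maximum of their quotient
  into a power lower bound to the right of it.\<close>

lemma circle_mean_growth:
  fixes lam :: "real \<Rightarrow> real" and k :: nat
  assumes f: "f holomorphic_on UNIV" and p: "1 < p"
    and x: "0 < x0" "x0 \<le> x"
    and lam: "0 < lam x0" "(lam has_real_derivative D) (at x0)"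
    and I0: "0 < circle_mean p f x0"
    and d: "0 < d" "\<And>y. 0 < y \<Longrightarrow> x0 - d < y \<Longrightarrow> y < x0 \<Longrightarrow>
        0 < lam y \<and> y ^ k * circle_mean p f y / lam y \<le> x0 ^ k * circle_mean p f x0 / lam x0"
  shows "x0 ^ k * circle_mean p f x0 * (x / x0) powr (x0 * D / lam x0) \<le> x ^ k * circle_mean p f x"
proof (rule ccontr)
  define m where "m = x0 * D / lam x0"
  define I where "I = circle_mean p f"
  assume "\<not> ?thesis"
  then have less: "x ^ k * I x < x0 ^ k * I x0 * (x / x0) powr m"
    by (simp add: m_def I_def)
  then have "x \<noteq> x0" using x by auto
  with x have x': "x0 < x" "0 < x" by auto
  \<comment> \<open>The failure is strict, so it persists for some exponent \<open>m'\<close>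
    slightly below \<open>m\<close>. The gap \<open>m - m'\<close> makes the comparison to the left
    of \<open>x0\<close> strict.\<close>
  have "((\<lambda>m. x0 ^ k * I x0 * (x / x0) powr m) \<longlongrightarrow> x0 ^ k * I x0 * (x / x0) powr m) (at_left m)"
    using x x' by (intro tendsto_intros) auto
  then have "\<forall>\<^sub>F m' in at_left m. x ^ k * I x < x0 ^ k * I x0 * (x / x0) powr m'"
    using less by (rule order_tendstoD)
  moreover have "\<forall>\<^sub>F m' in at_left m. m' < m"
    by (simp add: eventually_at_filter)
  ultimately obtain m' where m': "x ^ k * I x < x0 ^ k * I x0 * (x / x0) powr m'" "m' < m"
    using eventually_happens[OF eventually_conj] trivial_limit_at_left_real by blast
  define \<alpha> where "\<alpha> = real k - m'"
  have pw: "y powr \<alpha> = y ^ k * y powr (- m')" if "0 < y" for y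
    using that by (simp add: \<alpha>_def powr_diff powr_realpow powr_minus divide_inverse)
  have "x powr \<alpha> * I x = x ^ k * I x * x powr (- m')"
    using x' by (simp add: pw)
  also have "\<dots> < x0 ^ k * I x0 * (x / x0) powr m' * x powr (- m')"
    using m'(1) x' by simp
  also have "\<dots> = x0 powr \<alpha> * I x0"
    using x x' by (simp add: pw powr_divide powr_minus field_simps)
  finally have right: "x powr \<alpha> * I x < x0 powr \<alpha> * I x0" .
  \<comment> \<open>Log-convexity enters as the three circles inequality with a free exponent: the
    value at \<open>x0\<close> is at most the larger of those at \<open>y\<close> and
    \<open>x\<close>. By \<open>right\<close> the value at \<open>x\<close> is too small, so the one
    at \<open>y\<close> must dominate.\<close>
  have left: "x0 powr \<alpha> * I x0 \<le> y powr \<alpha> * I y" if y: "0 < y" "y < x0" for y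
  proof -
    have "x0 powr \<alpha> * I x0 \<le> max (y powr \<alpha> * I y) (x powr \<alpha> * I x)"
      unfolding I_def
      using y x' by (intro circle_mean_three_circles[OF f p, of y x0 x]) auto
    then show ?thesis using right by linarith
  qed
  \<comment> \<open>The logarithmic derivative at \<open>x0\<close> is \<open>(m - m') / x0\<close>,
    which is positive, so this product is strictly smaller just to the left of
    \<open>x0\<close>.\<close>
  have "((\<lambda>r. lam r * r powr (- m')) has_real_derivative
      (D * x0 powr (- m') + (- m' * x0 powr (- m' - 1)) * lam x0)) (at x0)"
    by (rule DERIV_mult[OF lam(2)]) (use x in \<open>auto intro!: derivative_eq_intros\<close>)
  moreover have "D * x0 powr (- m') + (- m' * x0 powr (- m' - 1)) * lam x0
      = x0 powr (- m' - 1) * lam x0 * (m - m')"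
    using x lam(1) by (simp add: m_def powr_diff field_simps)
  moreover have "\<dots> > 0"
    using x lam(1) m'(2) by simp
  ultimately have "\<exists>d'>0. \<forall>h>0. h < d' \<longrightarrow>
      lam (x0 - h) * (x0 - h) powr (- m') < lam x0 * x0 powr (- m')"
    by (intro DERIV_pos_inc_left[where f = "\<lambda>r. lam r * r powr (- m')"]) auto
  then obtain d' where d': "d' > 0"
    "\<And>h. h > 0 \<Longrightarrow> h < d' \<Longrightarrow> lam (x0 - h) * (x0 - h) powr (- m') < lam x0 * x0 powr (- m')"
    by blast
  \<comment> \<open>Halving the least of the three radii keeps \<open>y\<close> positive and
    strictly inside both left neighbourhoods of \<open>x0\<close>.\<close>
  define y where "y = x0 - min (min d d') x0 / 2"
  have y: "0 < y" "x0 - d < y" "y < x0" "x0 - d' < y"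
    using x(1) d(1) d'(1) by (auto simp: y_def)
  define Q where "Q = x0 ^ k * I x0 / lam x0"
  have Q: "0 < Q" using x lam I0 by (simp add: Q_def I_def)
  have lamy: "0 < lam y" "y ^ k * I y / lam y \<le> Q"
    using d(2)[OF y(1-3)] by (auto simp: Q_def I_def)
  have "y powr \<alpha> * I y = (y ^ k * I y / lam y) * (lam y * y powr (- m'))"
    using lamy y by (simp add: pw)
  also have "\<dots> \<le> Q * (lam y * y powr (- m'))"
    using lamy by (intro mult_right_mono) auto
  also have "\<dots> < Q * (lam x0 * x0 powr (- m'))"
    using Q d'(2)[of "x0 - y"] y by simp
  also have "\<dots> = x0 powr \<alpha> * I x0"
    using lam x by (simp add: Q_def pw)
  finally show False using left[OF y(1) y(3)] by simp
qed

text \<open>Dominated convergence: at each point the truncated functions are eventually 0.\<close>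

lemma nn_integral_tail_tendsto_0:
  fixes h :: "real \<Rightarrow> ennreal"
  assumes [measurable]: "h \<in> borel_measurable borel"
    and fin: "(\<integral>\<^sup>+ r. h r * indicator {0..} r \<partial>lborel) < \<infinity>"
  shows "(\<lambda>n::nat. \<integral>\<^sup>+ r. h r * indicator {real n..} r \<partial>lborel) \<longlonglongrightarrow> 0"
proof -
  have "(\<lambda>n::nat. \<integral>\<^sup>+ r. h r * indicator {real n..} r \<partial>lborel) \<longlonglongrightarrow> (\<integral>\<^sup>+ r. 0 \<partial>(lborel :: real measure))"
  proof (rule nn_integral_dominated_convergence[where w = "\<lambda>r. h r * indicator {0..} r"])
    show "AE r in lborel. (\<lambda>n. h r * indicator {real n..} r) \<longlonglongrightarrow> 0"
    proof (rule AE_I2)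
      fix r :: real
      obtain N :: nat where "r < real N" using reals_Archimedean2 by blast
      then have "\<forall>\<^sub>F n in sequentially. h r * indicator {real n..} r = 0"
        by (intro eventually_sequentiallyI[of N]) auto
      then show "(\<lambda>n. h r * indicator {real n..} r) \<longlonglongrightarrow> 0"
        by (rule tendsto_eventually)
    qed
  qed (use fin in \<open>auto split: split_indicator\<close>)
  then show ?thesis by simp
qed

lemma circle_mean_weighted_tendsto_0:
  fixes lam :: "real \<Rightarrow> real" and k :: nat
  assumes f: "f holomorphic_on UNIV" and p: "1 < p"
    and cont: "continuous_on UNIV lam" and pos: "\<And>x. 0 < lam x"
    and diff: "\<And>x. 0 < x \<Longrightarrow> lam differentiable at x"
    and S: "Liminf at_top (\<lambda>x. S_fun x lam) > 0"
    and fin: "(\<integral>\<^sup>+ r. ennreal (r ^ k * circle_mean p f r / lam r) * indicator {0..} r \<partial>lborel) < \<infinity>"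
  shows "((\<lambda>r. r ^ k * circle_mean p f r / lam r) \<longlongrightarrow> 0) at_top"
proof (rule ccontr)
  define h where "h r = r ^ k * circle_mean p f r / lam r" for r
  have hcont: "continuous_on A h" for A
    unfolding h_def using pos
    by (intro continuous_intros continuous_on_circle_mean[OF f p] continuous_on_subset[OF cont])
       (auto simp: less_imp_neq[symmetric])
  have hm[measurable]: "h \<in> borel_measurable borel"
    by (rule borel_measurable_continuous_onI[OF hcont])
  have lm[measurable]: "lam \<in> borel_measurable borel"
    by (rule borel_measurable_continuous_onI[OF cont])
  have h0: "0 \<le> h r" if "0 \<le> r" for r
    using that pos[of r] circle_mean_nonneg[OF f p] by (simp add: h_def)
  assume "\<not> ?thesis"
  then have nlim: "\<not> (h \<longlongrightarrow> 0) at_top" unfolding h_def by simp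
  have "\<exists>\<epsilon>>0. \<forall>R. \<exists>r\<ge>R. \<epsilon> \<le> h r"
  proof (rule ccontr)
    assume *: "\<not> ?thesis"
    have "(h \<longlongrightarrow> 0) at_top"
    proof (rule tendstoI)
      fix e :: real assume "0 < e"
      with * obtain R where R: "\<And>r. r \<ge> R \<Longrightarrow> h r < e" by (meson not_le)
      show "\<forall>\<^sub>F r in at_top. dist (h r) 0 < e"
        using eventually_ge_at_top[of R] eventually_ge_at_top[of "0::real"]
        by eventually_elim (use R h0 in auto)
    qed
    with nlim show False ..
  qed
  then obtain \<epsilon> where \<epsilon>: "0 < \<epsilon>" "\<And>R. \<exists>r\<ge>R. \<epsilon> \<le> h r" by blast
  obtain \<delta> where \<delta>: "0 < \<delta>" "\<delta> < Liminf at_top (\<lambda>x. S_fun x lam)"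
    using dense[OF S] by blast
  obtain R where R: "\<And>x. x \<ge> R \<Longrightarrow> \<delta> < S_fun x lam"
    using less_LiminfD[OF \<delta>(2)] by (auto simp: eventually_at_top_linorder)
  \<comment> \<open>A tail below \<open>\<epsilon>\<close> prevents \<open>h\<close> from staying
    above \<open>\<epsilon>\<close> on a unit interval; a tail below
    \<open>\<epsilon> * \<delta>\<close> contradicts the final lower bound through
    \<open>S_fun\<close>.\<close>
  define \<eta> where "\<eta> = ennreal \<epsilon> * min 1 \<delta>"
  have "0 < \<eta>" using \<epsilon> \<delta> by (auto simp: \<eta>_def ennreal_zero_less_mult_iff)
  have \<eta>: "\<eta> \<le> ennreal \<epsilon>" "\<eta> \<le> ennreal \<epsilon> * \<delta>"
    unfolding \<eta>_def using mult_left_mono[of "min 1 \<delta>" 1 "ennreal \<epsilon>"] by (auto intro: mult_left_mono)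
  have "(\<lambda>n::nat. \<integral>\<^sup>+ r. ennreal (h r) * indicator {real n..} r \<partial>lborel) \<longlonglongrightarrow> 0"
    using fin unfolding h_def[symmetric] by (intro nn_integral_tail_tendsto_0) auto
  from order_tendstoD(2)[OF this \<open>0 < \<eta>\<close>]
  have "\<forall>\<^sub>F n in sequentially. (\<integral>\<^sup>+ r. ennreal (h r) * indicator {real n..} r \<partial>lborel) < \<eta>
      \<and> n \<ge> nat \<lceil>R\<rceil> \<and> n \<ge> 1"
    by (intro eventually_conj eventually_ge_at_top)
  then obtain N :: nat where N: "(\<integral>\<^sup>+ r. ennreal (h r) * indicator {real N..} r \<partial>lborel) < \<eta>"
    "real N \<ge> R" "N \<ge> 1"
    using eventually_happens'[OF sequentially_bot] by (auto simp: nat_le_iff ceiling_le_iff)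
  have small: "\<exists>r\<ge>a. h r < \<epsilon>" if "a \<ge> real N" for a
  proof (rule ccontr)
    assume "\<not> ?thesis"
    then have ge: "\<epsilon> \<le> h r" if "r \<ge> a" for r using that by force
    have "ennreal \<epsilon> = (\<integral>\<^sup>+ r. ennreal \<epsilon> * indicator {a..a+1} r \<partial>lborel)"
      by (subst nn_integral_cmult_indicator) auto
    also have "\<dots> \<le> (\<integral>\<^sup>+ r. ennreal (h r) * indicator {real N..} r \<partial>lborel)"
      using ge that by (intro nn_integral_mono) (auto split: split_indicator intro!: ennreal_leI)
    also have "\<dots> < ennreal \<epsilon>" using N(1) \<eta>(1) by simp
    finally show False by simp
  qed
  \<comment> \<open>Since \<open>h\<close> is below \<open>\<epsilon>\<close> at \<open>a\<close>
    and at least \<open>\<epsilon>\<close> at \<open>b\<close>, a maximum point over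
    \<open>{a..c}\<close> lies strictly to the right of \<open>a\<close>, which leaves the left
    neighbourhood that \<open>circle_mean_growth\<close> asks for.\<close>
  obtain a where a: "a \<ge> real N" "h a < \<epsilon>" using small by blast
  obtain b where b: "b \<ge> a" "\<epsilon> \<le> h b" using \<epsilon>(2) by blast
  obtain c where c: "c \<ge> b" "h c < \<epsilon>" using small[of b] a b by auto
  obtain x0 where x0: "x0 \<in> {a..c}" and mx: "\<And>y. y \<in> {a..c} \<Longrightarrow> h y \<le> h x0"
    using continuous_attains_sup[OF compact_Icc _ hcont, of a c] a b c by auto
  have hx0: "\<epsilon> \<le> h x0" using mx[of b] b c by auto
  have ax0: "a < x0" using x0 hx0 a by (cases "a = x0") auto
  have x0N: "real N \<le> x0" "0 < x0" using ax0 a N(3) by auto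
  have I0: "0 < circle_mean p f x0"
    using hx0 \<epsilon>(1) circle_mean_nonneg[OF f p, of x0] by (cases "circle_mean p f x0 = 0") (auto simp: h_def)
  define m where "m = x0 * deriv lam x0 / lam x0"
  have D: "(lam has_real_derivative deriv lam x0) (at x0)"
    using diff[OF x0N(2)] by (simp add: DERIV_deriv_iff_real_differentiable)
  have growth: "x0 ^ k * circle_mean p f x0 * (x / x0) powr m \<le> x ^ k * circle_mean p f x" if "x \<ge> x0" for x
    unfolding m_def
  proof (rule circle_mean_growth[OF f p x0N(2) that pos D I0, where d = "x0 - a"])
    show "0 < lam y \<and> y ^ k * circle_mean p f y / lam y \<le> x0 ^ k * circle_mean p f x0 / lam x0"
      if "x0 - (x0 - a) < y" "y < x0" for y
      using mx[of y] that x0 pos[of y] by (auto simp: h_def)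
  qed (use ax0 in auto)
  \<comment> \<open>Divided by \<open>lam x\<close>, the growth bound becomes \<open>h x0\<close>
    times the integrand of \<open>S_fun x0 lam\<close>.\<close>
  have pt: "h x0 * (lam x0 / lam x * (x / x0) powr m) \<le> h x" if "x \<ge> x0" for x
    using growth[OF that] pos[of x] pos[of x0] by (simp add: h_def field_simps)
  have "ennreal \<epsilon> * \<delta> \<le> ennreal (h x0) * S_fun x0 lam"
    using hx0 R[of x0] x0N N(2) by (intro mult_mono ennreal_leI) auto
  also have "\<dots> = (\<integral>\<^sup>+ x. ennreal (h x0) * (indicator {x0..} x * ennreal (lam x0 / lam x * (x / x0) powr m)) \<partial>lborel)"
    unfolding S_fun_def m_def by (subst nn_integral_cmult) auto
  also have "\<dots> \<le> (\<integral>\<^sup>+ r. ennreal (h r) * indicator {real N..} r \<partial>lborel)"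
    using x0N pt h0[of x0] by (intro nn_integral_mono)
      (auto split: split_indicator intro!: ennreal_leI simp: ennreal_mult'[symmetric])
  also have "\<dots> < \<eta>" by (rule N(1))
  finally show False using \<eta>(2) by simp
qed

section \<open>From the area integral to the weighted limit\<close>

theorem theorem4p3:
  fixes p :: real and \<omega> :: "real \<Rightarrow> real" and f :: "complex \<Rightarrow> complex"
  assumes p: "1 < p"
    and an: "analytic_near_nonneg \<omega>"
    and pos: "\<And>x. x \<ge> 0 \<Longrightarrow> \<omega> x > 0"
    and noninc: "antimono_on {0..} \<omega>"
    and lam_pos: "\<And>x. x \<ge> 0 \<Longrightarrow> - 1 / deriv \<omega> (x ^ 2) > 0"
    and lam_inc: "strict_mono_on {0..} (\<lambda>x. - 1 / deriv \<omega> (x ^ 2))"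
    and lam_smooth: "smooth_on {0..} (\<lambda>x. - 1 / deriv \<omega> (x ^ 2))"
    and S_liminf: "Liminf at_top (\<lambda>x. S_fun x (\<lambda>x. - 1 / deriv \<omega> (x ^ 2))) > 0"
    and C: "\<exists>C>0. \<forall>\<^sub>F r in at_top. - deriv \<omega> r \<ge> C * \<omega> r"
    and entire: "f holomorphic_on UNIV"
    and D: "Dp_pow p f \<omega> < \<infinity>"
  shows "((\<lambda>r. r ^ 3 * Mp p r f powr p * \<omega> (r ^ 2)) \<longlongrightarrow> 0) at_top"
proof -
  define lam where "lam x = - 1 / deriv \<omega> (x ^ 2)" for x
  define I where "I = circle_mean p f"
  have I_nonneg: "0 \<le> I r" for r
    unfolding I_def by (rule circle_mean_nonneg[OF entire p])
  \<comment> \<open>The formula depends on \<open>x\<close> only through its square, so positivity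
    and continuity on the half-line extend to the whole line.\<close>
  have lam_abs: "lam \<bar>x\<bar> = lam x" for x by (simp add: lam_def)
  have lpos: "0 < lam x" for x
    using lam_pos[of "\<bar>x\<bar>"] lam_abs[of x] by (simp add: lam_def)
  have diff: "lam differentiable at x" if "0 \<le> x" for x
    using lam_smooth that unfolding smooth_on_def lam_def[abs_def] by (auto dest: spec[of _ 0])
  have "continuous_on {0..} lam"
    by (intro continuous_at_imp_continuous_on ballI differentiable_imp_continuous_within diff) auto
  then have "continuous_on UNIV (\<lambda>x. lam \<bar>x\<bar>)"
    by (rule continuous_on_compose2) (auto intro!: continuous_intros)
  then have cont: "continuous_on UNIV lam" by (simp add: lam_abs)
  then have [measurable]: "lam \<in> borel_measurable borel"
    by (rule borel_measurable_continuous_onI)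
  have [measurable]: "(\<lambda>z. norm (f z) powr p) \<in> borel_measurable borel"
    by (intro borel_measurable_continuous_onI continuous_on_norm_powr[OF entire p] continuous_intros)
  have d\<omega>: "deriv \<omega> (x\<^sup>2) = - 1 / lam x" for x by (simp add: lam_def)
  have "Dp_pow p f \<omega> = (\<integral>\<^sup>+ z. ennreal ((norm z)\<^sup>2 * norm (f z) powr p / lam (norm z)) \<partial>lborel)"
    unfolding Dp_pow_def d\<omega> by simp
  also have "\<dots> = (\<integral>\<^sup>+ r. ennreal r * indicator {0..} r * (\<integral>\<^sup>+ \<theta>.
      ennreal ((norm (of_real r * cis \<theta>))\<^sup>2 * norm (f (of_real r * cis \<theta>)) powr p / lam (norm (of_real r * cis \<theta>)))
        * indicator {0..2*pi} \<theta> \<partial>lborel) \<partial>lborel)"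
    by (rule nn_integral_polar) measurable
  \<comment> \<open>The third power combines the factor \<open>r\<close> of the polar area element
    with the weight \<open>r\<^sup>2\<close> in \<open>Dp_pow\<close>.\<close>
  also have "\<dots> = (\<integral>\<^sup>+ r. ennreal (r ^ 3 * I r / lam r) * indicator {0..} r \<partial>lborel)"
  proof (rule nn_integral_cong)
    fix r :: real
    have [measurable]: "cis \<in> borel_measurable borel"
      by (intro borel_measurable_continuous_onI continuous_intros)
    have "(\<integral>\<^sup>+ \<theta>. ennreal ((norm (of_real r * cis \<theta>))\<^sup>2 * norm (f (of_real r * cis \<theta>)) powr p / lam (norm (of_real r * cis \<theta>)))
        * indicator {0..2*pi} \<theta> \<partial>lborel) = ennreal (r\<^sup>2 / lam r * I r)" (is "?L = _") if "0 \<le> r"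
    proof -
      have "?L = (\<integral>\<^sup>+ \<theta>. ennreal (r\<^sup>2 / lam r) * (ennreal (norm (f (of_real r * cis \<theta>)) powr p) * indicator {0..2*pi} \<theta>) \<partial>lborel)"
        using lpos[of r] that by (intro nn_integral_cong)
          (auto simp: norm_mult ennreal_mult[symmetric] split: split_indicator)
      also have "\<dots> = ennreal (r\<^sup>2 / lam r) * ennreal (I r)"
        unfolding I_def nn_integral_circle[OF entire p, symmetric] by (rule nn_integral_cmult) measurable
      also have "\<dots> = ennreal (r\<^sup>2 / lam r * I r)"
        using lpos[of r] I_nonneg by (subst ennreal_mult) auto
      finally show ?thesis .
    qed
    then show "ennreal r * indicator {0..} r * (\<integral>\<^sup>+ \<theta>.
      ennreal ((norm (of_real r * cis \<theta>))\<^sup>2 * norm (f (of_real r * cis \<theta>)) powr p / lam (norm (of_real r * cis \<theta>)))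
        * indicator {0..2*pi} \<theta> \<partial>lborel) = ennreal (r ^ 3 * I r / lam r) * indicator {0..} r"
      using lpos[of r] I_nonneg[of r]
      by (cases "0 \<le> r") (auto simp: ennreal_mult[symmetric] power2_eq_square power3_eq_cube mult_ac)
  qed
  finally have "(\<integral>\<^sup>+ r. ennreal (r ^ 3 * I r / lam r) * indicator {0..} r \<partial>lborel) < \<infinity>"
    using D by simp
  then have lim: "((\<lambda>r. r ^ 3 * I r / lam r) \<longlongrightarrow> 0) at_top"
    unfolding I_def
    by (intro circle_mean_weighted_tendsto_0[OF entire p cont lpos diff])
       (use S_liminf in \<open>simp_all add: lam_def[abs_def]\<close>)
  have Mp: "Mp p r f powr p = I r" for r
    using p I_nonneg[of r] unfolding Mp_def I_def circle_mean_def
    by (simp add: powr_powr cis_conv_exp)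
  obtain C where C0: "0 < C" and "\<forall>\<^sub>F r in at_top. C * \<omega> r \<le> - deriv \<omega> r"
    using C by auto
  moreover have "filterlim (\<lambda>r::real. r\<^sup>2) at_top at_top"
    by (intro filterlim_pow_at_top filterlim_ident) auto
  \<comment> \<open>The growth condition is used at \<open>r\<^sup>2\<close>, where
    \<open>- deriv \<omega>\<close> equals \<open>1 / lam r\<close>; this bounds
    \<open>\<omega> (r\<^sup>2)\<close> by \<open>1 / lam r / C\<close>.\<close>
  ultimately have ev: "\<forall>\<^sub>F r in at_top. C * \<omega> (r\<^sup>2) \<le> - deriv \<omega> (r\<^sup>2)"
    by (auto simp: filterlim_iff)
  show ?thesis
  proof (rule tendsto_sandwich[where f = "\<lambda>_. 0" and h = "\<lambda>r. (r ^ 3 * I r / lam r) / C"])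
    show "((\<lambda>r. (r ^ 3 * I r / lam r) / C) \<longlongrightarrow> 0) at_top"
      using tendsto_divide[OF lim tendsto_const[of C]] C0 by simp
    show "\<forall>\<^sub>F r in at_top. 0 \<le> r ^ 3 * Mp p r f powr p * \<omega> (r\<^sup>2)"
      using eventually_ge_at_top[of "0::real"]
    proof eventually_elim
      case (elim r)
      then show ?case using pos[of "r\<^sup>2"] by simp
    qed
    show "\<forall>\<^sub>F r in at_top. r ^ 3 * Mp p r f powr p * \<omega> (r\<^sup>2) \<le> (r ^ 3 * I r / lam r) / C"
      using ev eventually_ge_at_top[of "0::real"]
    proof eventually_elim
      case (elim r)
      have "\<omega> (r\<^sup>2) \<le> 1 / lam r / C"
        using elim(1) C0 lpos[of r] by (simp add: d\<omega> field_simps)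
      then have "r ^ 3 * I r * \<omega> (r\<^sup>2) \<le> r ^ 3 * I r * (1 / lam r / C)"
        using elim(2) I_nonneg by (intro mult_left_mono) auto
      then show ?case by (simp add: Mp)
    qed
  qed simp
qed

end
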